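(* For all integers $n\ge 0$ and $k$, $$\mathfrak B_{2n}^{(k)}=\sum_{m=0}^n\frac{1}{(2m+1)^k}\sum_{\substack{i_1+\cdots+i_{2m}=n-m\\ i_1,\dots,i_{2m}\ge 0}}\left(-\frac14\right)^{n-m}\binom{2n}{2i_1+1,\dots,2i_{2m}+1},$$ where $\binom{2n}{2i_1+1,\dots,2i_{2m}+1}=\frac{\bigl((2i_1+1)+\cdots+(2i_{2m}+1)\bigr)!}{(2i_1+1)!\cdots(2i_{2m}+1)!}$ is the multinomial coefficient (for $m=0$ the inner sum is over the empty tuple, contributing $1$ if $n=0$ and $0$ otherwise).
   Context: For an integer $k$, the poly-Bernoulli numbers with level $2$, $\mathfrak B_n^{(k)}$, are defined by the power series identity $$\sum_{n=0}^\infty\mathfrak B_n^{(k)}\frac{x^n}{n!}=\frac{{\rm Li}_{2,k}\bigl(2\sin(x/2)\bigr)}{2\sin(x/2)}=\sum_{m=0}^\infty\frac{\bigl(2\sin(x/2)\bigr)^{2m}}{(2m+1)^k},$$ where ${\rm Li}_{2,k}(z)=\sum_{n=0}^\infty\frac{z^{2n+1}}{(2n+1)^k}$. *)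

theory Defs
  imports Complex_Main "HOL-Computational_Algebra.Formal_Power_Series"
begin

unbundle fps_syntax

text \<open>All power series are formal, with real coefficients.\<close>

definition Li2_fps :: "int \<Rightarrow> real fps" where
  "Li2_fps k = Abs_fps (\<lambda>j. if odd j then 1 / of_nat j powi k else 0)"

definition two_sin_half_fps :: "real fps" where
  "two_sin_half_fps = fps_const 2 * fps_sin (1 / 2)"

definition poly_bernoulli2 :: "int \<Rightarrow> nat \<Rightarrow> real" where
  "poly_bernoulli2 k n =
     fact n * ((Li2_fps k oo two_sin_half_fps) / two_sin_half_fps) $ n"

definition multinomial :: "nat list \<Rightarrow> real" where
  "multinomial js = fact (sum_list js) / prod_list (map fact js)"

text \<open>
  The divisor \<^term>\<open>two_sin_half_fps\<close> is not a unit. The following two lemmas show that the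
  division in the definition of \<^const>\<open>poly_bernoulli2\<close> is exact, and that the quotient is the
  expected series in even powers of the divisor.
\<close>

lemma two_sin_half_fps_nth_0 [simp]: "two_sin_half_fps $ 0 = 0"
  by (simp add: two_sin_half_fps_def fps_sin_def)

lemma two_sin_half_fps_nonzero [simp]: "two_sin_half_fps \<noteq> 0"
proof
  assume "two_sin_half_fps = 0"
  then have "two_sin_half_fps $ 1 = 0" by simp
  then show False by (simp add: two_sin_half_fps_def fps_sin_def)
qed

lemma poly_bernoulli2_fps_eq:
  "(Li2_fps k oo two_sin_half_fps) / two_sin_half_fps =
     Abs_fps (\<lambda>j. if even j then 1 / of_nat (j + 1) powi k else 0) oo two_sin_half_fps"
    (is "_ = ?P oo _")
proof -
  have "Li2_fps k = fps_X * ?P"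
    by (rule fps_ext) (auto simp: Li2_fps_def)
  then have "Li2_fps k oo two_sin_half_fps = two_sin_half_fps * (?P oo two_sin_half_fps)"
    by (simp add: fps_compose_mult_distrib)
  then show ?thesis by simp
qed

lemma poly_bernoulli2_fps_sums:
  "(\<lambda>m. fps_const (1 / of_nat (2 * m + 1) powi k) * two_sin_half_fps ^ (2 * m)) sums
     Abs_fps (\<lambda>n. poly_bernoulli2 k n / fact n)"
  unfolding sums_def
proof (rule tendsto_fpsI)
  fix n
  let ?s = two_sin_half_fps
  let ?f = "\<lambda>i. if even i then 1 / real (i + 1) powi k * (?s ^ i) $ n else 0"
  have zero: "(?s ^ i) $ n = 0" if "n < i" for i
    using that startsby_zero_power_prefix[of ?s i] by simp
  have "(\<Sum>m<N. fps_const (1 / of_nat (2 * m + 1) powi k) * ?s ^ (2 * m)) $ n =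
          Abs_fps (\<lambda>n. poly_bernoulli2 k n / fact n) $ n" if "N > n" for N
  proof -
    have "(\<Sum>m<N. fps_const (1 / of_nat (2 * m + 1) powi k) * ?s ^ (2 * m)) $ n =
            (\<Sum>m<N. ?f (2 * m))"
      by (simp add: fps_sum_nth)
    also have "\<dots> = (\<Sum>i\<in>(\<lambda>m. 2 * m) ` {..<N}. ?f i)"
      by (subst sum.reindex) (auto simp: inj_on_def)
    also have "\<dots> = (\<Sum>i\<in>{..<2 * N}. ?f i)"
      by (rule sum.mono_neutral_left) (auto elim!: evenE)
    also have "\<dots> = (\<Sum>i\<in>{0..n}. ?f i)"
      using that by (intro sum.mono_neutral_right) (auto simp: zero)
    also have "\<dots> = Abs_fps (\<lambda>n. poly_bernoulli2 k n / fact n) $ n"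
      by (simp add: poly_bernoulli2_def poly_bernoulli2_fps_eq fps_compose_nth if_distrib
            cong: if_cong) (rule sum.cong; simp)
    finally show ?thesis .
  qed
  then show "\<forall>\<^sub>F N in sequentially.
      (\<Sum>m<N. fps_const (1 / of_nat (2 * m + 1) powi k) * ?s ^ (2 * m)) $ n =
      Abs_fps (\<lambda>n. poly_bernoulli2 k n / fact n) $ n"
    by (rule eventually_mono[OF eventually_gt_at_top[of n]])
qed

end

theory Submission
  imports Defs "HOL-Computational_Algebra.Formal_Laurent_Series"
begin

text \<open>Write 2 sin(x/2) = x g(x^2), where g has coefficients (-1/4)^i / (2i+1)!
  (\<open>two_sin_half_fps_eq\<close>). Then (2 sin(x/2))^(2m) = x^(2m) g^(2m)(x^2), so its
  coefficient at x^(2n) is that of g^(2m) at index n-m: a sum over tuples i_1 + ... + i_(2m) = n-m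
  of products of coefficients of g (\<open>two_sin_half_fps_power_nth_even\<close>). In each product
  the powers of -1/4 combine to (-1/4)^(n-m). The odd numbers 2i_j+1 add up to 2(n-m) + 2m = 2n, so
  the factor (2n)! turns the reciprocal factorials into a multinomial coefficient
  (\<open>prod_list_odd_factorials\<close>). Powers with m > n start beyond degree 2n and contribute
  nothing.\<close>

lemma fps_power_nth_natpermute:
  fixes a :: "'a::comm_ring_1 fps"
  shows "(a ^ m) $ n = (\<Sum>v\<in>natpermute n m. \<Prod>i\<leftarrow>v. a $ i)"
proof -
  have "(\<Prod>i\<leftarrow>v. a $ i) = (\<Prod>j<m. a $ (v ! j))" if "v \<in> natpermute n m" for v
    using that by (simp add: natpermute_def prod.list_conv_set_nth atLeast0LessThan)
  then show ?thesis
    by (cases m) (auto simp: fps_power_nth natpermute_0 atLeast0AtMost lessThan_Suc_atMost simp del: power_Suc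
        intro!: sum.cong)
qed

lemma two_sin_half_fps_eq:
  "two_sin_half_fps =
     fps_X * (Abs_fps (\<lambda>i. (- 1 / 4) ^ i / fact (2 * i + 1)) oo fps_X ^ 2)"
    (is "_ = fps_X * (?g oo _)")
proof (rule fps_ext)
  fix j
  show "two_sin_half_fps $ j = (fps_X * (?g oo fps_X ^ 2)) $ j"
  proof (cases "even j")
    case True
    then show ?thesis
      by (cases j) (auto simp: two_sin_half_fps_def fps_sin_def fps_nth_compose_X_power)
  next
    case False
    then obtain i where j: "j = 2 * i + 1" by (rule oddE)
    \<comment> \<open>The outer factor 2 cancels one of the 2i+1 factors 1/2 coming from sin(x/2),
      leaving an even power of 1/2.\<close>
    have "(- 1 / 4 :: real) ^ i = (- 1) ^ i * (1 / 2) ^ (2 * i)"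
      by (simp add: power_mult power2_eq_square flip: power_mult_distrib)
    then show ?thesis
      by (simp add: j two_sin_half_fps_def fps_sin_def fps_nth_compose_X_power del: fact_Suc)
  qed
qed

lemma two_sin_half_fps_power_nth_even:
  assumes "m \<le> n"
  shows "(two_sin_half_fps ^ (2 * m)) $ (2 * n) =
    (\<Sum>is\<in>natpermute (n - m) (2 * m). \<Prod>i\<leftarrow>is. (- 1 / 4) ^ i / fact (2 * i + 1))"
proof -
  define g :: "real fps" where "g = Abs_fps (\<lambda>i. (- 1 / 4) ^ i / fact (2 * i + 1))"
  have "two_sin_half_fps ^ (2 * m) = fps_X ^ (2 * m) * (g ^ (2 * m) oo fps_X ^ 2)"
    by (simp add: two_sin_half_fps_eq g_def power_mult_distrib fps_compose_power)
  \<comment> \<open>Removing x^(2m) leaves degree 2n - 2m = 2(n-m), which is halved by undoing the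
    substitution of x^2.\<close>
  then have "(two_sin_half_fps ^ (2 * m)) $ (2 * n) = (g ^ (2 * m)) $ (n - m)"
    using assms by (simp add: fps_X_power_mult_nth fps_nth_compose_X_power flip: diff_mult_distrib2)
  then show ?thesis
    by (simp only: fps_power_nth_natpermute g_def fps_nth_Abs_fps)
qed

text \<open>The argument of the leading factorial is the sum of the odd numbers 2i+1 over the list,
  hence the numerator of the multinomial coefficient.\<close>

lemma prod_list_odd_factorials:
  "fact (2 * sum_list is + length is) * (\<Prod>i\<leftarrow>is. c ^ i / fact (2 * i + 1)) =
     c ^ sum_list is * multinomial (map (\<lambda>i. 2 * i + 1) is)"
proof -
  have "sum_list (map (\<lambda>i. 2 * i + 1) is) = 2 * sum_list is + length is"
    by (induction "is") auto
  moreover have "(\<Prod>i\<leftarrow>is. c ^ i / fact (2 * i + 1)) =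
      c ^ sum_list is / prod_list (map fact (map (\<lambda>i. 2 * i + 1) is))"
    by (induction "is") (auto simp: power_add)
  ultimately show ?thesis
    unfolding multinomial_def by simp
qed

theorem theorem5:
  fixes n :: nat and k :: int
  shows "poly_bernoulli2 k (2 * n) =
    (\<Sum>m = 0..n. 1 / of_nat (2 * m + 1) powi k *
      (\<Sum>is \<in> {is :: nat list. length is = 2 * m \<and> sum_list is = n - m}.
        (- 1 / 4) ^ (n - m) * multinomial (map (\<lambda>i. 2 * i + 1) is)))"
proof -
  let ?s = two_sin_half_fps
  let ?f = "\<lambda>i. if even i then 1 / real (i + 1) powi k * (?s ^ i) $ (2 * n) else 0"
  have "poly_bernoulli2 k (2 * n) = fact (2 * n) * (\<Sum>i=0..2*n. ?f i)"
    by (auto simp: poly_bernoulli2_def poly_bernoulli2_fps_eq fps_compose_nth intro!: sum.cong)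
  \<comment> \<open>Only even exponents i = 2m survive, since \<open>Li2_fps\<close> divided by its
    variable is an even series.\<close>
  also have "(\<Sum>i=0..2*n. ?f i) = (\<Sum>i\<in>(\<lambda>m. 2 * m) ` {0..n}. ?f i)"
    by (rule sum.mono_neutral_right) (auto elim!: evenE)
  also have "\<dots> = (\<Sum>m=0..n. ?f (2 * m))"
    by (subst sum.reindex) (auto simp: inj_on_def)
  also have "fact (2 * n) * \<dots> = (\<Sum>m=0..n. 1 / of_nat (2 * m + 1) powi k *
      (fact (2 * n) * (?s ^ (2 * m)) $ (2 * n)))"
    by (simp add: sum_distrib_left mult_ac)
  also have "\<dots> = (\<Sum>m = 0..n. 1 / of_nat (2 * m + 1) powi k *
      (\<Sum>is \<in> {is :: nat list. length is = 2 * m \<and> sum_list is = n - m}.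
        (- 1 / 4) ^ (n - m) * multinomial (map (\<lambda>i. 2 * i + 1) is)))"
  proof (rule sum.cong[OF refl], rule arg_cong[where f = "(*) _"])
    fix m assume "m \<in> {0..n}"
    then have m: "m \<le> n" by simp
    have "fact (2 * n) * (\<Prod>i\<leftarrow>is. (- 1 / 4) ^ i / fact (2 * i + 1)) =
        (- 1 / 4) ^ (n - m) * multinomial (map (\<lambda>i. 2 * i + 1) is)"
      if "length is = 2 * m" "sum_list is = n - m" for "is"
    proof -
      \<comment> \<open>Here m \<le> n matters: the subtraction n - m on naturals is then
        exact.\<close>
      have "2 * n = 2 * sum_list is + length is"
        using that m by simp
      then show ?thesis
        using prod_list_odd_factorials[of "is" "- 1 / 4"] that by simp
    qed
    then show "fact (2 * n) * (?s ^ (2 * m)) $ (2 * n) =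
        (\<Sum>is \<in> {is :: nat list. length is = 2 * m \<and> sum_list is = n - m}.
          (- 1 / 4) ^ (n - m) * multinomial (map (\<lambda>i. 2 * i + 1) is))"
      unfolding two_sin_half_fps_power_nth_even[OF m] sum_distrib_left
      by (intro sum.cong) (auto simp: natpermute_def)
  qed
  finally show ?thesis .
qed

end
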